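(* Let $p\ge2$ be a real number and let $c>0$. Then for all $x\in(0,c)$, $$e^{\lambda x^p}<\frac{x}{\sinh_p x}<e^{\eta x^p}$$ with the best possible constants $\lambda=-\dfrac{1}{p(p+1)}$ and $\eta=\dfrac{\ln(c/\sinh_p c)}{c^p}$. Here "best possible" means that $\lambda$ cannot be replaced by any larger constant, and $\eta$ cannot be replaced by any smaller constant, so that the respective inequality still holds for all $x\in(0,c)$.
   Context: For real $1<p<\infty$, define $\operatorname{arcsinh}_p:\mathbb{R}\to\mathbb{R}$ by $\operatorname{arcsinh}_p x=\int_0^x\frac{dt}{(1+t^p)^{1/p}}$ for $x\ge0$ and $\operatorname{arcsinh}_p x=-\operatorname{arcsinh}_p(-x)$ for $x<0$. The generalized hyperbolic sine function $\sinh_p$ is the inverse of $\operatorname{arcsinh}_p$. *)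

theory Defs
  imports "HOL-Analysis.Analysis"
begin

text \<open>Both functions are intended for \<open>1 < p\<close> only. The integral is the
  Henstock--Kurzweil integral of the library; the integrand is continuous on \<open>{0..x}\<close>,
  where \<open>0 powr p = 0\<close>.\<close>

definition arcsinh_p :: "real \<Rightarrow> real \<Rightarrow> real" where
  "arcsinh_p p x =
    (if 0 \<le> x then integral {0..x} (\<lambda>t. 1 / (1 + t powr p) powr (1 / p))
     else - integral {0..-x} (\<lambda>t. 1 / (1 + t powr p) powr (1 / p)))"

text \<open>For \<open>1 < p\<close> the function \<^term>\<open>arcsinh_p p\<close> is a bijection of the real line
  (the integrand decays like \<open>1 / t\<close>, so the integral is unbounded); hence
  the library inverse is the two-sided inverse.\<close>

definition sinh_p :: "real \<Rightarrow> real \<Rightarrow> real" where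
  "sinh_p p = inv (arcsinh_p p)"

end

theory Submission
  imports Defs
begin

text \<open>Substituting \<open>x = arcsinh_p y\<close> turns the quotient \<open>x / sinh_p x\<close> into
  \<open>A / y = exp (- \<Lambda> * A powr p)\<close>, where \<open>A = arcsinh_p y\<close> and
  \<open>\<Lambda> y = ln (y / A) / A powr p\<close>. Both inequalities and the optimality of both constants
  follow once \<open>\<Lambda>\<close> is known to decrease strictly on the positive half line
  and to tend to \<open>1 / (p * (p + 1)) = - lam\<close> at \<open>0\<close>; the value \<open>- eta\<close> is the value of
  \<open>\<Lambda>\<close> at the other end \<open>y = sinh_p c\<close>.

  The limit comes from \<open>A = y - y powr (p + 1) / (p * (p + 1)) + \<dots>\<close>
  (\<open>arcsinh_p_defect_tendsto\<close>, \<open>log_ratio_tendsto\<close>).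

  For the monotonicity put \<open>w = y powr p\<close>, \<open>s = (1 + w) powr (1 / p)\<close> and \<open>T = y / s\<close>,
  the functions \<open>sinh_p\<close> to the power \<open>p\<close>, \<open>cosh_p\<close> and \<open>tanh_p\<close> at \<open>x\<close>. They satisfy
  \<open>A' = 1 / s\<close>, \<open>w' = p * w / y\<close> and \<open>T' = 1 / (s * (1 + w))\<close>, so differentiation in \<open>y\<close> stays
  rational in \<open>y, w, s, T, A\<close>. Three functions are shown to be positive one after
  the other. Each tends to \<open>0\<close> at \<open>0\<close>, and the derivatives of the second and the third are the
  preceding function times a positive factor:
  \<^item> \<open>A - T * (1 + w / (p + 1 + p * (p - 1) * w))\<close> in \<open>arcsinh_p_lower_bound\<close>; its
    derivative no longer contains \<open>A\<close> and is positive by a polynomial inequality in \<open>w\<close>;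
  \<^item> \<open>A\<^sup>2 + (p - 1) * (1 + w) * T * A - p * (1 + w) * T\<^sup>2\<close> in \<open>arcsinh_p_quadratic_pos\<close>;
  \<^item> \<open>p * ln (y / A) - (A / T - 1)\<close> in \<open>log_quotient_lower_bound\<close>; up to a negative
    factor this is the derivative of \<open>\<Lambda>\<close>.\<close>

section \<open>The functions \<open>cosh_p\<close> and \<open>arcsinh_p\<close> in the variable \<open>y = sinh_p x\<close>\<close>

text \<open>The value of \<open>cosh_p = sinh_p'\<close> at the point where \<open>sinh_p\<close> takes the value \<open>y\<close>;
  the defining formula is the identity \<open>cosh_p powr p - sinh_p powr p = 1\<close>.\<close>

definition pcosh :: "real \<Rightarrow> real \<Rightarrow> real" where
  "pcosh p y = (1 + y powr p) powr (1 / p)"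

lemma pcosh_gt_1:
  assumes "0 < p" "0 < y"
  shows "1 < pcosh p y"
  using assms unfolding pcosh_def by (intro gr_one_powr) auto

lemma pcosh_pos: "0 \<le> y \<Longrightarrow> 0 < pcosh p y"
  unfolding pcosh_def by (simp add: add_pos_nonneg less_imp_neq[symmetric])

text \<open>The derivative is expressed through \<open>y powr p\<close> itself, so that later computations
  involve no shifted exponents.\<close>

lemma powr_has_derivative_quotient:
  fixes y p :: real
  assumes "0 < y"
  shows "((\<lambda>y. y powr p) has_real_derivative p * y powr p / y) (at y)"
  using has_real_derivative_powr[OF assms, of p] assms by (simp add: powr_diff)

lemma pcosh_has_derivative:
  assumes "0 < p" "0 < y"
  shows "(pcosh p has_real_derivative
           pcosh p y * (y powr p) / (y * (1 + y powr p))) (at y)"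
proof -
  have pos: "0 < 1 + y powr p"
    by (simp add: add_pos_nonneg)
  have "((\<lambda>y. (1 + y powr p) powr (1 / p)) has_real_derivative
      (1 / p) * (1 + y powr p) powr (1 / p - 1) * (p * y powr p / y)) (at y)"
    using DERIV_add[OF DERIV_const powr_has_derivative_quotient[OF assms(2), of p], of 1]
    by (intro DERIV_chain2[where g = "\<lambda>y. 1 + y powr p", OF has_real_derivative_powr[OF pos]]) simp
  then show ?thesis
    using assms pos unfolding pcosh_def by (simp add: powr_diff mult.commute)
qed

lemma arcsinh_p_nonneg_eq:
  "0 \<le> y \<Longrightarrow> arcsinh_p p y = integral {0..y} (\<lambda>t. 1 / pcosh p t)"
  by (simp add: arcsinh_p_def pcosh_def)

lemma continuous_on_inverse_pcosh:
  assumes "0 < p"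
  shows "continuous_on {0..b} (\<lambda>t. 1 / pcosh p t)"
proof -
  have "continuous_on {0..b} (\<lambda>t. 1 / (1 + t powr p) powr (1 / p))"
    using assms by (intro continuous_intros continuous_on_powr') (auto simp: add_nonneg_eq_0_iff)
  then show ?thesis by (simp add: pcosh_def)
qed

lemma arcsinh_p_has_derivative_within:
  assumes "0 < p" "0 \<le> y" "y \<le> b"
  shows "(arcsinh_p p has_real_derivative 1 / pcosh p y) (at y within {0..b})"
proof -
  have "((\<lambda>x. integral {0..x} (\<lambda>t. 1 / pcosh p t)) has_real_derivative 1 / pcosh p y)
      (at y within {0..b})"
    using assms by (intro integral_has_real_derivative continuous_on_inverse_pcosh) auto
  then show ?thesis
    by (rule has_field_derivative_transform_within[where d = 1])
      (use assms in \<open>auto simp: arcsinh_p_nonneg_eq\<close>)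
qed

lemma arcsinh_p_has_derivative:
  assumes "0 < p" "0 < y"
  shows "(arcsinh_p p has_real_derivative 1 / pcosh p y) (at y)"
  using arcsinh_p_has_derivative_within[of p y "y + 1"] assms
  by (simp add: at_within_Icc_at)

lemma arcsinh_p_0 [simp]: "arcsinh_p p 0 = 0"
  by (simp add: arcsinh_p_def)

text \<open>The quotient is the difference quotient of \<open>arcsinh_p\<close> at \<open>0\<close>, where the integrand
  has the value \<open>1\<close>.\<close>

lemma arcsinh_p_quotient_tendsto_1:
  assumes "0 < p"
  shows "((\<lambda>y. arcsinh_p p y / y) \<longlongrightarrow> 1) (at_right 0)"
proof -
  have "(arcsinh_p p has_real_derivative 1) (at 0 within {0..1})"
    using arcsinh_p_has_derivative_within[of p 0 1] assms by (simp add: pcosh_def)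
  then show ?thesis
    by (simp add: has_field_derivative_iff at_within_Icc_at_right)
qed

lemma arcsinh_p_tendsto_0:
  assumes "0 < p"
  shows "(arcsinh_p p \<longlongrightarrow> 0) (at_right 0)"
proof -
  have "((\<lambda>y. arcsinh_p p y / y * y) \<longlongrightarrow> 1 * 0) (at_right 0)"
    by (intro tendsto_mult arcsinh_p_quotient_tendsto_1 assms tendsto_ident_at)
  moreover have "\<forall>\<^sub>F y in at_right 0. arcsinh_p p y / y * y = arcsinh_p p y"
    by (rule eventually_at_rightI[of 0 1]) auto
  ultimately show ?thesis
    using Lim_transform_eventually by fastforce
qed

lemma powr_tendsto_0:
  fixes p :: real
  assumes "0 < p"
  shows "((\<lambda>y. y powr p) \<longlongrightarrow> 0) (at_right 0)"
proof -
  have "((\<lambda>y::real. y powr p) \<longlongrightarrow> 0 powr p) (at_right 0)"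
    using assms by (intro tendsto_powr' tendsto_intros) (auto simp: eventually_at_right_less intro: eventually_at_rightI[of 0 1])
  then show ?thesis using assms by simp
qed

lemma pcosh_tendsto_1:
  assumes "0 < p"
  shows "(pcosh p \<longlongrightarrow> 1) (at_right 0)"
proof -
  have "((\<lambda>y. (1 + y powr p) powr (1 / p)) \<longlongrightarrow> (1 + 0) powr (1 / p)) (at_right 0)"
    by (intro tendsto_intros powr_tendsto_0 assms) auto
  then show ?thesis by (simp add: pcosh_def[abs_def])
qed

text \<open>The criterion behind every inequality below. The functions involve
  quotients by \<open>y\<close> and are only meaningful for \<open>y > 0\<close>, hence a one-sided limit at \<open>0\<close>
  in place of continuity.\<close>

lemma positive_if_derivative_positive:
  fixes f f' :: "real \<Rightarrow> real"
  assumes lim: "(f \<longlongrightarrow> 0) (at_right 0)"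
    and deriv: "\<And>y. 0 < y \<Longrightarrow> (f has_real_derivative f' y) (at y)"
    and pos: "\<And>y. 0 < y \<Longrightarrow> 0 < f' y"
    and y: "0 < y"
  shows "0 < f y"
proof -
  have less: "f u < f v" if "0 < u" "u < v" for u v
    using that deriv pos by (intro DERIV_pos_imp_increasing[of u v f]) (auto, meson less_le_trans)
  have "0 \<le> f (y / 2)"
  proof (rule tendsto_upperbound[OF lim])
    show "\<forall>\<^sub>F u in at_right 0. f u \<le> f (y / 2)"
      using y by (intro eventually_at_rightI[of 0 "y / 2"]) (auto intro!: less_imp_le[OF less])
  qed simp
  also have "f (y / 2) < f y" using y by (intro less) auto
  finally show ?thesis .
qed

lemma arcsinh_p_pos:
  assumes "0 < p" "0 < y"
  shows "0 < arcsinh_p p y"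
  using assms
  by (intro positive_if_derivative_positive[where f = "arcsinh_p p" and f' = "\<lambda>y. 1 / pcosh p y"]
      arcsinh_p_tendsto_0 arcsinh_p_has_derivative) (auto simp: pcosh_pos)

lemma arcsinh_p_less:
  assumes "0 < p" "0 < y"
  shows "arcsinh_p p y < y"
proof -
  have "0 < y - arcsinh_p p y"
  proof (rule positive_if_derivative_positive[where y = y and
        f = "\<lambda>y. y - arcsinh_p p y" and f' = "\<lambda>y. 1 - 1 / pcosh p y"])
    show "((\<lambda>y. y - arcsinh_p p y) \<longlongrightarrow> 0) (at_right 0)"
      using tendsto_diff[OF tendsto_ident_at arcsinh_p_tendsto_0[OF assms(1)]] by simp
    show "0 < 1 - 1 / pcosh p y" if "0 < y" for y
      using pcosh_gt_1[OF assms(1) that] by simp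
  qed (use assms in \<open>auto intro!: derivative_eq_intros arcsinh_p_has_derivative\<close>)
  then show ?thesis by simp
qed

section \<open>Monotonicity of the logarithmic ratio\<close>

definition ptanh :: "real \<Rightarrow> real \<Rightarrow> real" where
  "ptanh p y = y / pcosh p y"

lemma ptanh_pos: "0 < y \<Longrightarrow> 0 < ptanh p y"
  by (simp add: ptanh_def pcosh_pos)

lemma ptanh_tendsto_0:
  assumes "0 < p"
  shows "(ptanh p \<longlongrightarrow> 0) (at_right 0)"
  using tendsto_divide[OF tendsto_ident_at pcosh_tendsto_1[OF assms]]
  by (simp add: ptanh_def[abs_def])

lemma ptanh_has_derivative:
  assumes "0 < p" "0 < y"
  shows "(ptanh p has_real_derivative 1 / (pcosh p y * (1 + y powr p))) (at y)"
proof -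
  define s w where "s = pcosh p y" and "w = y powr p"
  have sw: "0 < s" "0 < w" "0 < 1 + w"
    using assms pcosh_pos[of y p] by (auto simp: s_def w_def add_pos_pos)
  have "((\<lambda>y. y / pcosh p y) has_real_derivative
      (1 * s - y * (s * w / (y * (1 + w)))) / (s * s)) (at y)"
    using DERIV_divide[OF DERIV_ident pcosh_has_derivative[OF assms]] sw
    by (simp add: s_def w_def)
  also have "(1 * s - y * (s * w / (y * (1 + w)))) / (s * s) = 1 / (s * (1 + w))"
    using sw assms by (simp add: divide_simps) (simp add: algebra_simps)
  finally show ?thesis by (simp add: s_def w_def ptanh_def[abs_def])
qed

text \<open>The coefficients \<open>p + 1\<close> and \<open>p * (p - 1)\<close> are those for which the bound is equivalent
  to the positivity of the derivative in \<open>arcsinh_p_quadratic_pos\<close>. The difference of both sides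
  vanishes at \<open>0\<close>, and after clearing denominators its derivative is
  \<open>w\<^sup>2 * (2 * p * (p\<^sup>2 - p - 1) + (p * (p - 1))\<^sup>2 * w)\<close> up to a positive factor. This is where the
  size of \<open>p\<close> matters: \<open>p\<^sup>2 - p - 1\<close> is positive exactly above the golden ratio.\<close>

lemma arcsinh_p_lower_bound:
  assumes p: "2 \<le> p" and y: "0 < y"
  shows "ptanh p y * (1 + y powr p / (p + 1 + p * (p - 1) * y powr p)) < arcsinh_p p y"
proof -
  have p0: "0 < p" using p by simp
  define a b where "a = p + 1" and "b = p * (p - 1)"
  have ab: "0 < a" "0 < b" using p by (auto simp: a_def b_def)
  define R where "R y = ptanh p y * (1 + y powr p / (a + b * y powr p))" for y
  \<comment> \<open>\<open>X\<close> is the derivative of the lower bound \<open>R\<close> relative to that of \<open>arcsinh_p\<close>.\<close>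
  define X where "X w = (1 + w / (a + b * w)) / (1 + w) + p * a * w / (a + b * w)\<^sup>2" for w
  have R_deriv: "(R has_real_derivative X (y powr p) / pcosh p y) (at y)" if y: "0 < y" for y
  proof -
    define s w where "s = pcosh p y" and "w = y powr p"
    have sw: "0 < s" "0 < w" "0 < 1 + w" "0 < a + b * w"
      using y ab pcosh_pos[of y p] by (auto simp: s_def w_def add_pos_pos)
    have w': "((\<lambda>y. y powr p) has_real_derivative p * w / y) (at y)"
      using powr_has_derivative_quotient[OF y, of p] by (simp add: w_def)
    have "((\<lambda>w. 1 + w / (a + b * w)) has_real_derivative a / (a + b * w)\<^sup>2) (at w)"
      using sw by (auto intro!: derivative_eq_intros simp: power2_eq_square algebra_simps)
    then have "((\<lambda>y. 1 + y powr p / (a + b * y powr p)) has_real_derivative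
        a / (a + b * w)\<^sup>2 * (p * w / y)) (at y)"
      unfolding w_def
      by (rule DERIV_chain2[where g = "\<lambda>y. y powr p"]) (rule w'[unfolded w_def])
    from DERIV_mult[OF ptanh_has_derivative[OF p0 y] this]
    have "(R has_real_derivative
        1 / (s * (1 + w)) * (1 + w / (a + b * w)) + a / (a + b * w)\<^sup>2 * (p * w / y) * (y / s)) (at y)"
      by (simp add: R_def[abs_def] s_def w_def ptanh_def)
    also have "a / (a + b * w)\<^sup>2 * (p * w / y) * (y / s) = p * a * w / (a + b * w)\<^sup>2 / s"
      using y by simp
    also have "1 / (s * (1 + w)) * (1 + w / (a + b * w)) + p * a * w / (a + b * w)\<^sup>2 / s = X w / s"
      by (simp add: X_def add_divide_distrib mult.commute)
    finally show ?thesis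
      by (simp add: s_def w_def)
  qed
  have X_less_1: "X w < 1" if w: "0 < w" for w
  proof -
    have D: "0 < 1 + w" "0 < a + b * w" using w ab by (auto simp: add_pos_pos)
    have golden: "0 < p * p - p - 1"
    proof -
      have "2 * p \<le> p * p" using p by (intro mult_right_mono) auto
      then show ?thesis using p by linarith
    qed
    have 1: "(1 + w / (a + b * w)) / (1 + w) * ((1 + w) * (a + b * w)\<^sup>2)
        = (a + b * w)\<^sup>2 + w * (a + b * w)"
    proof -
      have "(1 + w / (a + b * w)) / (1 + w) * ((1 + w) * (a + b * w)\<^sup>2)
          = (1 + w / (a + b * w)) * (a + b * w)\<^sup>2"
        using D by simp
      also have "\<dots> = (a + b * w)\<^sup>2 + w / (a + b * w) * ((a + b * w) * (a + b * w))"
        by (simp only: distrib_right mult_1_left power2_eq_square)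
      also have "w / (a + b * w) * ((a + b * w) * (a + b * w)) = w * (a + b * w)"
        using D by simp
      finally show ?thesis .
    qed
    have 2: "p * a * w / (a + b * w)\<^sup>2 * ((1 + w) * (a + b * w)\<^sup>2) = p * a * w * (1 + w)"
      using D by simp
    have "(1 - X w) * ((1 + w) * (a + b * w)\<^sup>2) =
        (1 + w) * (a + b * w)\<^sup>2 - ((a + b * w)\<^sup>2 + w * (a + b * w) + p * a * w * (1 + w))"
      unfolding X_def left_diff_distrib distrib_right[of "_ / _" "_ / _"] 1 2 by simp
    also have "\<dots> = w\<^sup>2 * (2 * p * (p * p - p - 1) + b\<^sup>2 * w)"
      unfolding a_def b_def by (simp add: algebra_simps power2_eq_square)
    also have "\<dots> > 0"
      using w p golden ab by (intro mult_pos_pos add_pos_pos) auto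
    finally have "0 < 1 - X w"
      by (rule zero_less_mult_pos2) (use D in simp)
    then show ?thesis by simp
  qed
  have "0 < arcsinh_p p y - R y"
  proof (rule positive_if_derivative_positive[where y = y and f = "\<lambda>y. arcsinh_p p y - R y"
        and f' = "\<lambda>y. 1 / pcosh p y - X (y powr p) / pcosh p y"])
    have "(R \<longlongrightarrow> 0 * (1 + 0 / (a + b * 0))) (at_right 0)"
      unfolding R_def using p0 ab
      by (intro tendsto_intros powr_tendsto_0 ptanh_tendsto_0) auto
    then show "((\<lambda>y. arcsinh_p p y - R y) \<longlongrightarrow> 0) (at_right 0)"
      using tendsto_diff[OF arcsinh_p_tendsto_0[OF p0], of R 0] by simp
  next
    fix y :: real assume y: "0 < y"
    then show "((\<lambda>y. arcsinh_p p y - R y) has_real_derivative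
        1 / pcosh p y - X (y powr p) / pcosh p y) (at y)"
      by (intro DERIV_diff arcsinh_p_has_derivative R_deriv p0)
    show "0 < 1 / pcosh p y - X (y powr p) / pcosh p y"
      using X_less_1[of "y powr p"] pcosh_pos[of y p] y by (simp flip: diff_divide_distrib)
  qed (use y in auto)
  then show ?thesis by (simp add: R_def a_def b_def)
qed

text \<open>This quadratic expression in \<open>A = arcsinh_p y\<close> is the numerator of the derivative in
  \<open>log_quotient_lower_bound\<close>. The coefficient of \<open>A\<^sup>2\<close> being constant,
  differentiation lowers the degree in \<open>A\<close> to one, and positivity of the derivative becomes a lower
  bound for \<open>A\<close>.\<close>

lemma arcsinh_p_quadratic_pos:
  assumes p: "2 \<le> p" and y: "0 < y"
  shows "0 < (arcsinh_p p y)\<^sup>2 + (p - 1) * ((1 + y powr p) * ptanh p y) * arcsinh_p p y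
             - p * ((1 + y powr p) * ptanh p y) * ptanh p y" (is "0 < ?K y")
proof -
  have p0: "0 < p" using p by simp
  define K' where "K' y = 1 / pcosh p y *
    (arcsinh_p p y * (p + 1 + p * (p - 1) * y powr p)
      - ptanh p y * (p + 1 + (p\<^sup>2 - p + 1) * y powr p))" for y
  show ?thesis
  proof (rule positive_if_derivative_positive[where f = ?K and f' = K' and y = y])
    have "(?K \<longlongrightarrow> 0\<^sup>2 + (p - 1) * ((1 + 0) * 0) * 0 - p * ((1 + 0) * 0) * 0) (at_right 0)"
      by (intro tendsto_intros powr_tendsto_0 ptanh_tendsto_0 arcsinh_p_tendsto_0 p0)
    then show "(?K \<longlongrightarrow> 0) (at_right 0)"
      by simp
  next
    fix y :: real assume y: "0 < y"
    define s w A T where "s = pcosh p y" and "w = y powr p" and "A = arcsinh_p p y"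
      and "T = ptanh p y"
    have sw: "0 < s" "0 < w" "0 < 1 + w"
      using y pcosh_pos[of y p] by (auto simp: s_def w_def add_pos_pos)
    have T_eq: "T = y / s" by (simp add: T_def s_def ptanh_def)
    have A': "(arcsinh_p p has_real_derivative 1 / s) (at y)"
      using arcsinh_p_has_derivative[OF p0 y] by (simp add: s_def)
    have T': "(ptanh p has_real_derivative 1 / (s * (1 + w))) (at y)"
      using ptanh_has_derivative[OF p0 y] by (simp add: s_def w_def)
    have U': "((\<lambda>y. (1 + y powr p) * ptanh p y) has_real_derivative (1 + p * w) / s) (at y)"
    proof -
      have "((\<lambda>y. 1 + y powr p) has_real_derivative 0 + p * w / y) (at y)"
        unfolding w_def by (intro DERIV_add DERIV_const powr_has_derivative_quotient y)
      from DERIV_mult[OF this T']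
      have "((\<lambda>y. (1 + y powr p) * ptanh p y) has_real_derivative
          p * w / y * T + 1 / (s * (1 + w)) * (1 + w)) (at y)"
        by (simp add: T_def w_def)
      also have "1 / (s * (1 + w)) * (1 + w) = 1 / s"
        using sw by simp
      also have "p * w / y * T + 1 / s = (1 + p * w) / s"
        using y sw by (simp add: T_eq add_divide_distrib)
      finally show ?thesis .
    qed
    have "(?K has_real_derivative
        2 * A * (1 / s)
        + ((p - 1) * ((1 + p * w) / s) * A + 1 / s * ((p - 1) * ((1 + w) * T)))
        - (p * ((1 + p * w) / s) * T + 1 / (s * (1 + w)) * (p * ((1 + w) * T)))) (at y)"
      unfolding w_def A_def T_def
      by (intro DERIV_add DERIV_diff DERIV_mult DERIV_cmult U'[unfolded w_def]
          A' T'[unfolded w_def] DERIV_cong[OF DERIV_power[OF A', of 2]]) simp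
    also have "1 / (s * (1 + w)) * (p * ((1 + w) * T)) = p * T / s"
      using sw by simp
    also have "2 * A * (1 / s)
        + ((p - 1) * ((1 + p * w) / s) * A + 1 / s * ((p - 1) * ((1 + w) * T)))
        - (p * ((1 + p * w) / s) * T + p * T / s)
        = 1 / s * (2 * A + ((p - 1) * (1 + p * w) * A + (p - 1) * ((1 + w) * T))
            - (p * (1 + p * w) * T + p * T))"
      using sw by (simp add: field_simps)
    also have "2 * A + ((p - 1) * (1 + p * w) * A + (p - 1) * ((1 + w) * T))
            - (p * (1 + p * w) * T + p * T)
        = A * (p + 1 + p * (p - 1) * w) - T * (p + 1 + (p\<^sup>2 - p + 1) * w)"
      by (simp add: algebra_simps power2_eq_square)
    finally show "(?K has_real_derivative K' y) (at y)"
      by (simp add: K'_def s_def w_def A_def T_def)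
    have D: "0 < p + 1 + p * (p - 1) * w" using p sw by (intro add_pos_pos mult_pos_pos) auto
    have "(1 + w / d) * d = d + w" if "0 < d" for d
      using that by (simp add: distrib_right)
    from this[OF D] have "p + 1 + (p\<^sup>2 - p + 1) * w
        = (1 + w / (p + 1 + p * (p - 1) * w)) * (p + 1 + p * (p - 1) * w)"
      by (simp only:) (simp add: algebra_simps power2_eq_square)
    then have "T * (p + 1 + (p\<^sup>2 - p + 1) * w)
        = T * (1 + w / (p + 1 + p * (p - 1) * w)) * (p + 1 + p * (p - 1) * w)"
      by simp
    also have "\<dots> < A * (p + 1 + p * (p - 1) * w)"
      using arcsinh_p_lower_bound[OF p y] D
      by (intro mult_strict_right_mono) (auto simp: T_def w_def A_def)
    finally show "0 < K' y"
      using sw unfolding K'_def s_def[symmetric] w_def[symmetric] A_def[symmetric] T_def[symmetric]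
      by (intro mult_pos_pos) auto
  qed (use y in auto)
qed

lemma log_quotient_has_derivative:
  assumes "0 < p" "0 < y"
  shows "((\<lambda>y. ln (y / arcsinh_p p y)) has_real_derivative
      1 / y - 1 / pcosh p y / arcsinh_p p y) (at y)"
proof (rule has_field_derivative_transform_within_open[where S = "{0<..}"])
  show "((\<lambda>y. ln y - ln (arcsinh_p p y)) has_real_derivative
      1 / y - 1 / pcosh p y / arcsinh_p p y) (at y)"
    using assms arcsinh_p_pos[OF assms]
    by (auto intro!: derivative_eq_intros arcsinh_p_has_derivative)
  show "ln z - ln (arcsinh_p p z) = ln (z / arcsinh_p p z)" if "z \<in> {0<..}" for z
    using that arcsinh_p_pos[OF assms(1), of z] by (simp add: ln_div)
qed (use assms in auto)

text \<open>The difference of both sides tends to \<open>0\<close> at \<open>0\<close> because \<open>A / y\<close> and \<open>cosh_p\<close> tend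
  to \<open>1\<close>; its derivative is the quadratic expression above divided by \<open>(1 + w) * T\<^sup>2 * s * A\<close>.\<close>

lemma log_quotient_lower_bound:
  assumes p: "2 \<le> p" and y: "0 < y"
  shows "arcsinh_p p y / ptanh p y - 1 < p * ln (y / arcsinh_p p y)"
proof -
  have p0: "0 < p" using p by simp
  define K where "K y = (arcsinh_p p y)\<^sup>2 + (p - 1) * ((1 + y powr p) * ptanh p y) * arcsinh_p p y
             - p * ((1 + y powr p) * ptanh p y) * ptanh p y" for y
  have K: "0 < K y" if "0 < y" for y
    using arcsinh_p_quadratic_pos[OF p that] by (simp add: K_def)
  define G where "G y = p * ln (y / arcsinh_p p y) - (arcsinh_p p y / ptanh p y - 1)" for y
  define G' where "G' y = K y / ((1 + y powr p) * (ptanh p y)\<^sup>2 * pcosh p y * arcsinh_p p y)" for y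
  have "0 < G y"
  proof (rule positive_if_derivative_positive[where y = y and f = G and f' = G'])
    have quot: "((\<lambda>y. y / arcsinh_p p y) \<longlongrightarrow> 1) (at_right 0)"
      using tendsto_inverse[OF arcsinh_p_quotient_tendsto_1[OF p0]] by simp
    have "((\<lambda>y. p * ln (y / arcsinh_p p y) - (pcosh p y * (arcsinh_p p y / y) - 1))
        \<longlongrightarrow> p * ln 1 - (1 * 1 - 1)) (at_right 0)"
      by (intro tendsto_intros quot pcosh_tendsto_1 arcsinh_p_quotient_tendsto_1 p0) auto
    then show "(G \<longlongrightarrow> 0) (at_right 0)"
      by (simp add: G_def[abs_def] ptanh_def mult.commute)
  next
    fix y :: real assume y: "0 < y"
    define s w A T where "s = pcosh p y" and "w = y powr p" and "A = arcsinh_p p y"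
      and "T = ptanh p y"
    have pos: "0 < s" "0 < w" "0 < 1 + w" "0 < A" "0 < T"
      using y p0 pcosh_pos[of y p] arcsinh_p_pos[of p y] ptanh_pos[of y p]
      by (auto simp: s_def w_def A_def T_def add_pos_pos)
    have T_eq: "y = T * s" using pos by (simp add: T_def s_def ptanh_def)
    have A': "(arcsinh_p p has_real_derivative 1 / s) (at y)"
      using arcsinh_p_has_derivative[OF p0 y] by (simp add: s_def)
    have T': "(ptanh p has_real_derivative 1 / (s * (1 + w))) (at y)"
      using ptanh_has_derivative[OF p0 y] by (simp add: s_def w_def)
    have L': "((\<lambda>y. ln (y / arcsinh_p p y)) has_real_derivative 1 / y - 1 / s / A) (at y)"
      by (rule log_quotient_has_derivative[OF p0 y, folded s_def A_def])
    have "(G has_real_derivative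
        p * (1 / y - 1 / s / A)
        - ((1 / s * T - A * (1 / (s * (1 + w)))) / (T * T) - 0)) (at y)"
      unfolding G_def[abs_def] A_def T_def using pos
      by (intro DERIV_diff DERIV_cmult DERIV_divide DERIV_const
          L'[unfolded A_def] A' T') (simp add: T_def)
    also have "p * (1 / y - 1 / s / A)
        - ((1 / s * T - A * (1 / (s * (1 + w)))) / (T * T) - 0)
        = (A\<^sup>2 + (p - 1) * ((1 + w) * T) * A - p * ((1 + w) * T) * T) / ((1 + w) * T\<^sup>2 * s * A)"
      unfolding T_eq using pos
      by (simp add: divide_simps power2_eq_square) (simp add: algebra_simps)
    finally show "(G has_real_derivative G' y) (at y)"
      by (simp add: G'_def K_def s_def w_def A_def T_def)
    show "0 < G' y"
      using pos K[OF y] by (simp add: G'_def s_def w_def A_def T_def)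
  qed (use y in auto)
  then show ?thesis by (simp add: G_def)
qed

text \<open>In terms of \<open>x = arcsinh_p y\<close> this is \<open>- ln (x / sinh_p x) / x powr p\<close>: its negative is
  the constant for which the exponential bound is attained at \<open>x\<close>.\<close>

definition log_ratio :: "real \<Rightarrow> real \<Rightarrow> real" where
  "log_ratio p y = ln (y / arcsinh_p p y) / (arcsinh_p p y) powr p"

text \<open>By the quotient rule the derivative has the sign of \<open>(A / T - 1) - p * ln (y / A)\<close>.\<close>

lemma log_ratio_strict_decreasing:
  assumes p: "2 \<le> p" and "0 < u" "u < v"
  shows "log_ratio p v < log_ratio p u"
proof (rule DERIV_neg_imp_decreasing[OF \<open>u < v\<close>])
  fix y assume "u \<le> y" "y \<le> v"
  with \<open>0 < u\<close> have y: "0 < y" by simp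
  define s A where "s = pcosh p y" and "A = arcsinh_p p y"
  define P where "P = A powr p"
  have sA: "0 < s" "0 < A" "0 < P"
    using y p pcosh_pos[of y p] arcsinh_p_pos[of p y] by (auto simp: s_def A_def P_def)
  have powr: "((\<lambda>y. arcsinh_p p y powr p) has_real_derivative p * P / A * (1 / s)) (at y)"
    unfolding P_def A_def s_def using y p arcsinh_p_pos[of p y]
    by (intro DERIV_chain2[OF powr_has_derivative_quotient arcsinh_p_has_derivative]) auto
  from DERIV_divide[OF log_quotient_has_derivative[of p y] powr]
  have "(log_ratio p has_real_derivative
      ((1 / y - 1 / s / A) * P - ln (y / A) * (p * P / A * (1 / s))) / (P * P)) (at y)"
    using y p sA by (simp add: log_ratio_def[abs_def] s_def A_def P_def)
  also have "((1 / y - 1 / s / A) * P - ln (y / A) * (p * P / A * (1 / s))) / (P * P)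
      = (s * A / y - 1 - p * ln (y / A)) / (P * A * s)"
    using sA y by (simp add: divide_simps) (simp add: algebra_simps)
  finally have "(log_ratio p has_real_derivative
      (s * A / y - 1 - p * ln (y / A)) / (P * A * s)) (at y)" .
  moreover have "(s * A / y - 1 - p * ln (y / A)) / (P * A * s) < 0"
    using log_quotient_lower_bound[OF p y] sA
    by (intro divide_neg_pos) (auto simp: s_def A_def ptanh_def mult.commute)
  ultimately show "\<exists>d. (log_ratio p has_real_derivative d) (at y) \<and> d < 0"
    by blast
qed

section \<open>The limit of the logarithmic ratio at zero\<close>

text \<open>One application of l'Hospital's rule leaves \<open>(1 - (1 + w) powr (- 1 / p)) / ((p + 1) * w)\<close>
  with \<open>w = y powr p\<close>, essentially a difference quotient at \<open>w = 0\<close>.\<close>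

lemma arcsinh_p_defect_tendsto:
  assumes p: "0 < p"
  shows "((\<lambda>y. (y - arcsinh_p p y) / (y * y powr p)) \<longlongrightarrow> 1 / (p * (p + 1))) (at_right 0)"
proof (rule lhopital_right_0)
  have "((\<lambda>w. (1 + w) powr (- 1 / p)) has_real_derivative - 1 / p) (at 0)"
    by (auto intro!: derivative_eq_intros)
  then have lim0: "((\<lambda>w. ((1 + w) powr (- 1 / p) - 1) / w) \<longlongrightarrow> - 1 / p) (at 0)"
    by (simp add: has_field_derivative_iff)
  have w0: "filterlim (\<lambda>y::real. y powr p) (at 0) (at_right 0)"
    unfolding filterlim_at using powr_tendsto_0[OF p]
    by (auto intro!: eventually_at_rightI[of 0 1])
  have "((\<lambda>y. - (((1 + y powr p) powr (- 1 / p) - 1) / y powr p) / (p + 1))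
      \<longlongrightarrow> - (- 1 / p) / (p + 1)) (at_right 0)"
    using p by (intro tendsto_intros filterlim_compose[OF lim0 w0]) auto
  also have "- (- 1 / p) / (p + 1) = 1 / (p * (p + 1))" using p by simp
  finally show "((\<lambda>y. (1 - 1 / pcosh p y) / ((p + 1) * y powr p)) \<longlongrightarrow> 1 / (p * (p + 1))) (at_right 0)"
    by (rule Lim_transform_eventually[OF _ eventually_at_rightI[of 0 1]])
      (use p in \<open>auto simp: pcosh_def powr_minus_divide divide_simps algebra_simps\<close>)
  show "((\<lambda>y. y - arcsinh_p p y) \<longlongrightarrow> 0) (at_right 0)"
    using tendsto_diff[OF tendsto_ident_at arcsinh_p_tendsto_0[OF p]] by simp
  show "((\<lambda>y. y * y powr p) \<longlongrightarrow> 0) (at_right 0)"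
    using tendsto_mult[OF tendsto_ident_at powr_tendsto_0[OF p]] by simp
  show "\<forall>\<^sub>F y in at_right 0. ((\<lambda>y. y * y powr p) has_real_derivative (p + 1) * y powr p) (at y)"
    by (rule eventually_at_rightI[of 0 1])
      (auto intro!: derivative_eq_intros powr_has_derivative_quotient simp: powr_diff algebra_simps)
  show "\<forall>\<^sub>F y in at_right 0. ((\<lambda>y. y - arcsinh_p p y) has_real_derivative 1 - 1 / pcosh p y) (at y)"
    by (rule eventually_at_rightI[of 0 1])
      (auto intro!: derivative_eq_intros arcsinh_p_has_derivative p)
qed (use p in \<open>auto intro!: eventually_at_rightI[of 0 1]\<close>)

text \<open>With \<open>u = 1 - A / y\<close> the ratio factors as
  \<open>(- ln (1 - u) / u) * (u / y powr p) / (A / y) powr p\<close>. The outer factors tend to \<open>1\<close>, and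
  the middle one is the quotient of \<open>arcsinh_p_defect_tendsto\<close>.\<close>

lemma log_ratio_tendsto:
  assumes p: "0 < p"
  shows "(log_ratio p \<longlongrightarrow> 1 / (p * (p + 1))) (at_right 0)"
proof -
  define u where "u y = 1 - arcsinh_p p y / y" for y
  have "((\<lambda>u::real. ln (1 - u)) has_real_derivative - 1) (at 0)"
    by (auto intro!: derivative_eq_intros)
  then have lim0: "((\<lambda>u::real. ln (1 - u) / u) \<longlongrightarrow> - 1) (at 0)"
    by (simp add: has_field_derivative_iff)
  have u_pos: "0 < u y" if "0 < y" for y
    using arcsinh_p_less[OF p that] that by (simp add: u_def)
  have "(u \<longlongrightarrow> 0) (at_right 0)"
    using tendsto_diff[OF tendsto_const arcsinh_p_quotient_tendsto_1[OF p], of 1]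
    by (simp add: u_def[abs_def])
  then have u0: "filterlim u (at 0) (at_right 0)"
    unfolding filterlim_at using u_pos by (auto intro!: eventually_at_rightI[of 0 1] simp: less_imp_neq[symmetric])
  have "((\<lambda>y. - (ln (1 - u y) / u y) * ((y - arcsinh_p p y) / (y * y powr p))
      / (arcsinh_p p y / y) powr p) \<longlongrightarrow> - (- 1) * (1 / (p * (p + 1))) / 1 powr p) (at_right 0)"
    using p by (intro tendsto_intros filterlim_compose[OF lim0 u0]
        arcsinh_p_defect_tendsto arcsinh_p_quotient_tendsto_1) auto
  then have "((\<lambda>y. - (ln (1 - u y) / u y) * ((y - arcsinh_p p y) / (y * y powr p))
      / (arcsinh_p p y / y) powr p) \<longlongrightarrow> 1 / (p * (p + 1))) (at_right 0)"
    by simp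
  then show ?thesis
  proof (rule Lim_transform_eventually[OF _ eventually_at_rightI[of 0 1]])
    fix y :: real assume "y \<in> {0<..<1}"
    then have y: "0 < y" by simp
    define A where "A = arcsinh_p p y"
    have A: "0 < A" "0 < A powr p" "0 < y powr p"
      using y arcsinh_p_pos[OF p y] by (auto simp: A_def)
    have 1: "(y - A) / (y * y powr p) = u y / y powr p"
      using y by (simp add: u_def A_def field_simps)
    have 2: "(A / y) powr p = A powr p / y powr p"
      using A y by (simp add: powr_divide)
    have 3: "ln (1 - u y) = - ln (y / A)"
      using A y by (simp add: u_def ln_div flip: A_def)
    have "- (ln (1 - u y) / u y) * ((y - A) / (y * y powr p)) / (A / y) powr p
        = ln (y / A) / A powr p"
      unfolding 1 2 3 using A y u_pos[OF y] by simp
    then show "- (ln (1 - u y) / u y) * ((y - arcsinh_p p y) / (y * y powr p))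
        / (arcsinh_p p y / y) powr p = log_ratio p y"
      by (simp add: A_def log_ratio_def)
  qed simp
qed

lemma log_ratio_less:
  assumes p: "2 \<le> p" and y: "0 < y"
  shows "log_ratio p y < 1 / (p * (p + 1))"
proof -
  have "log_ratio p y < log_ratio p (y / 2)"
    using p y by (intro log_ratio_strict_decreasing) auto
  also have "log_ratio p (y / 2) \<le> 1 / (p * (p + 1))"
  proof (rule tendsto_lowerbound[OF log_ratio_tendsto])
    show "\<forall>\<^sub>F u in at_right 0. log_ratio p (y / 2) \<le> log_ratio p u"
      using p y by (intro eventually_at_rightI[of 0 "y / 2"])
        (auto intro!: less_imp_le log_ratio_strict_decreasing)
  qed (use p in auto)
  finally show ?thesis .
qed

section \<open>The inverse function \<open>sinh_p\<close>\<close>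

lemma arcsinh_p_strict_mono:
  assumes p: "0 < p" and "0 \<le> u" "u < v"
  shows "arcsinh_p p u < arcsinh_p p v"
proof (cases "u = 0")
  case True
  then show ?thesis using arcsinh_p_pos[OF p, of v] assms by simp
next
  case False
  have "\<exists>d. (arcsinh_p p has_real_derivative d) (at y) \<and> 0 < d" if "u \<le> y" for y
    using False that assms arcsinh_p_has_derivative[OF p, of y] pcosh_pos[of y p]
    by (intro exI[of _ "1 / pcosh p y"]) auto
  then show ?thesis
    using DERIV_pos_imp_increasing[OF \<open>u < v\<close>, of "arcsinh_p p"] by auto
qed

text \<open>For \<open>t \<ge> 1\<close> the integrand is at least \<open>1 / (2 * t)\<close>, since
  \<open>1 + t powr p \<le> (2 * t) powr p\<close>.\<close>

lemma arcsinh_p_unbounded: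
  assumes p: "1 \<le> p" and y: "1 \<le> y"
  shows "ln y / 2 \<le> arcsinh_p p y"
proof -
  have "arcsinh_p p 1 - ln 1 / 2 \<le> arcsinh_p p y - ln y / 2"
  proof (rule DERIV_nonneg_imp_nondecreasing[OF y])
    fix t :: real assume t: "1 \<le> t" "t \<le> y"
    have "1 + t powr p \<le> 2 * t powr p"
      using t p by (simp add: ge_one_powr_ge_zero)
    also have "\<dots> \<le> 2 powr p * t powr p"
      using powr_mono[of 1 p 2] p by (intro mult_right_mono) auto
    also have "\<dots> = (2 * t) powr p"
      using t by (simp add: powr_mult)
    finally have "pcosh p t \<le> ((2 * t) powr p) powr (1 / p)"
      unfolding pcosh_def using p by (intro powr_mono2) (auto simp: add_nonneg_nonneg)
    then have "pcosh p t \<le> 2 * t"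
      using t p by (simp add: powr_powr)
    then have "1 / (2 * t) \<le> 1 / pcosh p t"
      using pcosh_pos[of t p] t by (intro divide_left_mono) auto
    then show "\<exists>d. ((\<lambda>y. arcsinh_p p y - ln y / 2) has_real_derivative d) (at t) \<and> 0 \<le> d"
      using t p by (intro exI[of _ "1 / pcosh p t - 1 / (2 * t)"])
        (auto intro!: derivative_eq_intros arcsinh_p_has_derivative)
  qed
  then show ?thesis using arcsinh_p_pos[of p 1] p by simp
qed

text \<open>By the logarithmic lower bound, \<open>exp (2 * x)\<close> is a point where \<open>arcsinh_p\<close> has
  reached \<open>x\<close>, so the intermediate value theorem applies.\<close>

lemma arcsinh_p_surj_pos:
  assumes p: "1 \<le> p" and x: "0 < x"
  shows "\<exists>y>0. arcsinh_p p y = x"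
proof -
  have ge1: "1 \<le> exp (2 * x)" using x by simp
  have "\<exists>y\<ge>0. y \<le> exp (2 * x) \<and> arcsinh_p p y = x"
  proof (rule IVT')
    show "x \<le> arcsinh_p p (exp (2 * x))"
      using arcsinh_p_unbounded[OF p ge1] by simp
    show "continuous_on {0..exp (2 * x)} (arcsinh_p p)"
      using p by (intro DERIV_continuous_on[where D = "\<lambda>y. 1 / pcosh p y"]
          arcsinh_p_has_derivative_within) auto
  qed (use x in auto)
  then obtain y where "0 \<le> y" "arcsinh_p p y = x" by blast
  then show ?thesis using x by (intro exI[of _ y]) (auto simp: less_le)
qed

text \<open>The inverse refers to the whole real line; a second preimage on the negative side is
  excluded because \<open>arcsinh_p\<close> is odd by definition and positive on positive arguments.\<close>

lemma sinh_p_arcsinh_p: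
  assumes p: "1 \<le> p" and y: "0 < y"
  shows "sinh_p p (arcsinh_p p y) = y"
  unfolding sinh_p_def inv_into_def
proof (rule some_equality)
  fix z assume "z \<in> UNIV \<and> arcsinh_p p z = arcsinh_p p y"
  then have eq: "arcsinh_p p z = arcsinh_p p y" by simp
  have Ay: "0 < arcsinh_p p y" using arcsinh_p_pos[of p y] p y by simp
  have "0 \<le> z"
  proof (rule ccontr)
    assume "\<not> 0 \<le> z"
    then have "arcsinh_p p z = - arcsinh_p p (- z)" and "0 < arcsinh_p p (- z)"
      using arcsinh_p_pos[of p "- z"] p by (auto simp: arcsinh_p_def)
    with eq Ay show False by simp
  qed
  then show "z = y"
    using arcsinh_p_strict_mono[of p z y] arcsinh_p_strict_mono[of p y z] p y eq
    by (cases z y rule: linorder_cases) auto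
qed simp

lemma sinh_p_right_inverse:
  assumes p: "1 \<le> p" and x: "0 < x"
  shows "0 < sinh_p p x \<and> arcsinh_p p (sinh_p p x) = x"
  using arcsinh_p_surj_pos[OF p x] sinh_p_arcsinh_p[OF p] by auto

lemma arcsinh_p_quotient_eq_exp:
  assumes p: "0 < p" and y: "0 < y"
  shows "arcsinh_p p y / y = exp (- log_ratio p y * arcsinh_p p y powr p)"
  using arcsinh_p_pos[OF p y] y by (simp add: log_ratio_def exp_minus)

section \<open>The sharp exponential bounds\<close>

theorem theorem3p4:
  fixes p c lam eta :: real
  assumes p: "2 \<le> p"
    and c: "0 < c"
    and lam: "lam = - (1 / (p * (p + 1)))"
    and eta: "eta = ln (c / sinh_p p c) / c powr p"
  shows "(\<forall>x\<in>{0<..<c}. exp (lam * x powr p) < x / sinh_p p x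
                     \<and> x / sinh_p p x < exp (eta * x powr p))
    \<and> \<not> (\<exists>lam'>lam. \<forall>x\<in>{0<..<c}. exp (lam' * x powr p) < x / sinh_p p x)
    \<and> \<not> (\<exists>eta'<eta. \<forall>x\<in>{0<..<c}. x / sinh_p p x < exp (eta' * x powr p))"
proof -
  have p0: "0 < p" and p1: "1 \<le> p" using p by auto
  define Y where "Y = sinh_p p c"
  have Y: "0 < Y" "arcsinh_p p Y = c"
    using sinh_p_right_inverse[OF p1 c] by (auto simp: Y_def)
  have eta_Y: "eta = - log_ratio p Y"
    using Y c by (simp add: eta log_ratio_def ln_div minus_divide_left flip: Y_def)
  have in_range: "arcsinh_p p y \<in> {0<..<c}" if "0 < y" "y < Y" for y
    using that arcsinh_p_pos[OF p0, of y] arcsinh_p_strict_mono[OF p0, of y Y] Y by auto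
  have "exp (lam * x powr p) < x / sinh_p p x \<and> x / sinh_p p x < exp (eta * x powr p)"
    if x: "x \<in> {0<..<c}" for x
  proof -
    define y where "y = sinh_p p x"
    have y: "0 < y" "arcsinh_p p y = x"
      using sinh_p_right_inverse[OF p1, of x] x by (auto simp: y_def)
    have "y < Y"
      using arcsinh_p_strict_mono[OF p0, of Y y] Y y x by (cases y Y rule: linorder_cases) auto
    have "lam < - log_ratio p y" "- log_ratio p y < eta"
      using log_ratio_less[OF p y(1)] log_ratio_strict_decreasing[OF p y(1) \<open>y < Y\<close>]
      by (auto simp: lam eta_Y)
    then have "lam * x powr p < - log_ratio p y * x powr p" "- log_ratio p y * x powr p < eta * x powr p"
      using x by (intro mult_strict_right_mono; simp)+
    then show ?thesis
      using arcsinh_p_quotient_eq_exp[OF p0 y(1)]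
      unfolding y(2) y_def[symmetric] by simp
  qed
  \<comment> \<open>Let \<open>y\<close> tend to \<open>0\<close> in the inequality assumed for \<open>lam'\<close>.\<close>
  moreover have "lam' \<le> lam" if H: "\<forall>x\<in>{0<..<c}. exp (lam' * x powr p) < x / sinh_p p x" for lam'
  proof -
    have "log_ratio p y \<le> - lam'" if y: "0 < y" "y < Y" for y
    proof -
      have "exp (lam' * arcsinh_p p y powr p) < arcsinh_p p y / y"
        using H in_range[OF y] sinh_p_arcsinh_p[OF p1 y(1)] by force
      then have "lam' < - log_ratio p y"
        unfolding arcsinh_p_quotient_eq_exp[OF p0 y(1)] exp_less_cancel_iff
        by (rule mult_right_less_imp_less) simp
      then show ?thesis by simp
    qed
    then have "1 / (p * (p + 1)) \<le> - lam'"
      using Y by (intro tendsto_upperbound[OF log_ratio_tendsto[OF p0]])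
        (auto intro!: eventually_at_rightI[of 0 Y])
    then show ?thesis by (simp add: lam)
  qed
  \<comment> \<open>Let \<open>y\<close> tend to \<open>Y\<close>. In the variable \<open>y\<close> the limit rests on the continuity of
    \<open>arcsinh_p\<close>.\<close>
  moreover have "eta \<le> eta'" if H: "\<forall>x\<in>{0<..<c}. x / sinh_p p x < exp (eta' * x powr p)" for eta'
  proof -
    have "isCont (arcsinh_p p) Y"
      using arcsinh_p_has_derivative[OF p0 Y(1)] by (rule DERIV_isCont)
    then have "(arcsinh_p p \<longlongrightarrow> arcsinh_p p Y) (at_left Y)"
      unfolding isCont_def by (rule tendsto_within_subset) simp
    then have lim: "(log_ratio p \<longlongrightarrow> log_ratio p Y) (at_left Y)"
      unfolding log_ratio_def[abs_def] using Y c by (intro tendsto_intros) auto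
    have "- eta' \<le> log_ratio p y" if y: "0 < y" "y < Y" for y
    proof -
      have "arcsinh_p p y / y < exp (eta' * arcsinh_p p y powr p)"
        using H in_range[OF y] sinh_p_arcsinh_p[OF p1 y(1)] by force
      then have "- log_ratio p y < eta'"
        unfolding arcsinh_p_quotient_eq_exp[OF p0 y(1)] exp_less_cancel_iff
        by (rule mult_right_less_imp_less) simp
      then show ?thesis by simp
    qed
    then have "- eta' \<le> log_ratio p Y"
      using Y by (intro tendsto_lowerbound[OF lim]) (auto intro!: eventually_at_leftI[of 0 Y])
    then show ?thesis by (simp add: eta_Y)
  qed
  ultimately show ?thesis by (metis not_less)
qed

end
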